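(* Let $M$ be a finite-dimensional (type I) nonclassical representation of $U^{\iota}_{-q^2}(\mathfrak{so}_m)$. For $v\in M$, the formulae $$\beta_i(v):=\sum_{k\ge0}q^{-k}\,\mathsf{x}_i^{(k)}\cdot v,\qquad 1\le i\le m-1,$$ determine an action of the $m$-strand braid group $\mathrm{Br}_m$ (with standard generators $\beta_1,\dots,\beta_{m-1}$) on $M$.
   Context: $[k]_v=\frac{v^k-v^{-k}}{v-v^{-1}}$, $[k]=[k]_q$, $q$ an indeterminate; for $k\le\ell$, $D(k,\ell)=\sum_{i=0}^{k-1}(-1)^i[\ell+k-1-2i]$, so $D(k,k)=[k]_{q^2}$. $U^{\iota}_{-q^2}(\mathfrak{so}_m)$ is the unital associative $\mathbb{C}(q)$-algebra with generators $b_1,\dots,b_{m-1}$ and relations $b_ib_j=b_jb_i$ for $|i-j|>1$ and $b_i^2b_{i\pm1}+b_{i\pm1}b_i^2=-[2]_{q^2}\,b_ib_{i\pm1}b_i+b_{i\pm1}$. The nonclassical $\iota$divided powers are $\mathsf{x}_i^{(0)}=1$, $\mathsf{x}_i=\mathsf{x}_i^{(1)}=b_i-\frac1{[2]}$, and $\mathsf{x}_i^{(k+1)}=\frac{(-1)^k}{[k+1]_{q^2}}\big(\mathsf{x}_i^{(k)}\mathsf{x}_i-(-1)^kD(k,k+1)\,\mathsf{x}_i^{(k)}\big)$ for $k\ge1$. A finite-dimensional (type I) nonclassical representation is one (over $\mathbb{C}(q)$) on which every $b_i$ is diagonalizable with all eigenvalues in $\{(-1)^k\frac{[2k+1]}{[2]}\}_{k\in\mathbb{Z}_{\ge0}}$;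 equivalently, $\mathsf{x}_i^{(k)}$ acts by zero for all $i$ and all $k\gg0$, so the sums are finite. *)

theory Defs
  imports
    "HOL-Computational_Algebra.Fraction_Field"
    "HOL-Computational_Algebra.Polynomial"
    "HOL-Library.Poly_Mapping"
    "HOL-Library.Groups_Big_Fun"
    "HOL-Algebra.QuotRing"
    "HOL-Algebra.Group_Action"
begin

section \<open>The ground field and quantum integers\<close>

type_synonym Cq = "complex poly fract"

definition qq :: Cq where
  "qq = Fraction_Field.Fract [:0, 1:] 1"

definition qint :: "Cq \<Rightarrow> int \<Rightarrow> Cq" where
  "qint v k = (v powi k - v powi (- k)) / (v - inverse v)"

definition qD :: "nat \<Rightarrow> nat \<Rightarrow> Cq" where
  "qD k l = (\<Sum>i<k. (- 1) ^ i * qint qq (int l + int k - 1 - 2 * int i))"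


section \<open>The free associative algebra over \<open>\<complex>(q)\<close>\<close>

text \<open>Words in the letters \<open>0, 1, 2, \<dots>\<close> under concatenation, written additively so that
  the convolution product of \<^theory>\<open>HOL-Library.Poly_Mapping\<close> is the free algebra product.\<close>

datatype free_word = Word (letters: "nat list")

instantiation free_word :: monoid_add
begin

definition zero_free_word :: free_word where
  "0 = Word []"

definition plus_free_word :: "free_word \<Rightarrow> free_word \<Rightarrow> free_word" where
  "u + w = Word (letters u @ letters w)"

instance
  by standard (auto simp: zero_free_word_def plus_free_word_def)

end

type_synonym free_elem = "free_word \<Rightarrow>\<^sub>0 Cq"

definition fscal :: "Cq \<Rightarrow> free_elem" where
  "fscal c = Poly_Mapping.single 0 c"

definition fgen :: "nat \<Rightarrow> free_elem" where
  "fgen i = Poly_Mapping.single (Word [i]) 1"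

definition free_alg :: "nat \<Rightarrow> free_elem ring" where
  "free_alg m = \<lparr>carrier = {p. \<forall>w \<in> Poly_Mapping.keys p. set (letters w) \<subseteq> {1..<m}},
     mult = (*), one = 1, zero = 0, add = (+)\<rparr>"

lemma ring_free_alg: "ring (free_alg m)"
proof (rule ringI)
  show "abelian_group (free_alg m)"
  proof (rule abelian_groupI)
    fix x assume x: "x \<in> carrier (free_alg m)"
    have "- x \<in> carrier (free_alg m)" using x by (auto simp: free_alg_def)
    then show "\<exists>y\<in>carrier (free_alg m). y \<oplus>\<^bsub>free_alg m\<^esub> x = \<zero>\<^bsub>free_alg m\<^esub>"
      by (intro bexI[of _ "- x"]) (auto simp: free_alg_def)
  qed (use Poly_Mapping.keys_add in \<open>fastforce simp: free_alg_def algebra_simps\<close>)+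
  show "Group.monoid (free_alg m)"
  proof (rule monoidI)
    fix x y assume "x \<in> carrier (free_alg m)" "y \<in> carrier (free_alg m)"
    then show "x \<otimes>\<^bsub>free_alg m\<^esub> y \<in> carrier (free_alg m)"
      using keys_mult[of x y] by (fastforce simp: free_alg_def plus_free_word_def)
  qed (auto simp: free_alg_def algebra_simps zero_free_word_def)
qed (auto simp: free_alg_def algebra_simps)


section \<open>The algebra \<open>U\<^sup>\<iota>\<close> of \<open>so\<^sub>m\<close> at parameter \<open>-q\<^sup>2\<close>\<close>

text \<open>Each relation \<open>l = r\<close> is recorded as the element \<open>l - r\<close>.\<close>

definition so_rels :: "nat \<Rightarrow> free_elem set" where
  "so_rels m =
     {fgen i * fgen j - fgen j * fgen i | i j.
        i \<in> {1..<m} \<and> j \<in> {1..<m} \<and> \<bar>int i - int j\<bar> > 1} \<union>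
     {(fgen i ^ 2 * fgen j + fgen j * fgen i ^ 2)
        - (fscal (- qint (qq ^ 2) 2) * fgen i * fgen j * fgen i + fgen j) | i j.
        i \<in> {1..<m} \<and> j \<in> {1..<m} \<and> \<bar>int i - int j\<bar> = 1}"

definition so_ideal :: "nat \<Rightarrow> free_elem set" where
  "so_ideal m = genideal (free_alg m) (so_rels m)"

definition Uso :: "nat \<Rightarrow> free_elem set ring" where
  "Uso m = free_alg m Quot so_ideal m"

definition Uscal :: "nat \<Rightarrow> Cq \<Rightarrow> free_elem set" where
  "Uscal m c = so_ideal m +>\<^bsub>free_alg m\<^esub> fscal c"

definition Ugen :: "nat \<Rightarrow> nat \<Rightarrow> free_elem set" where
  "Ugen m i = so_ideal m +>\<^bsub>free_alg m\<^esub> fgen i"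

definition Ux :: "nat \<Rightarrow> nat \<Rightarrow> free_elem set" where
  "Ux m i = Ugen m i \<ominus>\<^bsub>Uso m\<^esub> Uscal m (1 / qint qq 2)"

text \<open>\<open>idivpow m i k\<close> is \<open>x\<^sub>i\<^sup>(\<^sup>k\<^sup>)\<close>; the third equation is the recursion at index \<open>Suc k\<close>.\<close>

fun idivpow :: "nat \<Rightarrow> nat \<Rightarrow> nat \<Rightarrow> free_elem set" where
  "idivpow m i 0 = \<one>\<^bsub>Uso m\<^esub>"
| "idivpow m i (Suc 0) = Ux m i"
| "idivpow m i (Suc (Suc k)) =
     Uscal m ((- 1) ^ Suc k / qint (qq ^ 2) (int (Suc (Suc k)))) \<otimes>\<^bsub>Uso m\<^esub>
       (idivpow m i (Suc k) \<otimes>\<^bsub>Uso m\<^esub> Ux m i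
        \<ominus>\<^bsub>Uso m\<^esub> Uscal m ((- 1) ^ Suc k * qD (Suc k) (Suc (Suc k))) \<otimes>\<^bsub>Uso m\<^esub> idivpow m i (Suc k))"


section \<open>Nonclassical representations\<close>

definition End_ring :: "(Cq \<Rightarrow> 'v \<Rightarrow> 'v) \<Rightarrow> ('v::ab_group_add \<Rightarrow> 'v) ring" where
  "End_ring scale = \<lparr>carrier = {f. Vector_Spaces.linear scale scale f},
     mult = (\<circ>), one = id, zero = (\<lambda>v. 0), add = (\<lambda>f g v. f v + g v)\<rparr>"

definition so_representation ::
  "nat \<Rightarrow> (Cq \<Rightarrow> 'v \<Rightarrow> 'v) \<Rightarrow> (free_elem set \<Rightarrow> 'v::ab_group_add \<Rightarrow> 'v) \<Rightarrow> bool" where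
  "so_representation m scale \<phi> \<longleftrightarrow>
     \<phi> \<in> ring_hom (Uso m) (End_ring scale) \<and> (\<forall>c. \<phi> (Uscal m c) = scale c)"

definition diagonalizable :: "(Cq \<Rightarrow> 'v \<Rightarrow> 'v) \<Rightarrow> ('v::ab_group_add \<Rightarrow> 'v) \<Rightarrow> bool" where
  "diagonalizable scale f \<longleftrightarrow>
     (\<exists>B. \<not> module.dependent scale B \<and> module.span scale B = UNIV \<and>
          (\<forall>v\<in>B. \<exists>c. f v = scale c v))"

definition eigenvalues :: "(Cq \<Rightarrow> 'v \<Rightarrow> 'v) \<Rightarrow> ('v::ab_group_add \<Rightarrow> 'v) \<Rightarrow> Cq set" where
  "eigenvalues scale f = {c. \<exists>v. v \<noteq> 0 \<and> f v = scale c v}"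

definition nonclassical_rep ::
  "nat \<Rightarrow> (Cq \<Rightarrow> 'v \<Rightarrow> 'v) \<Rightarrow> (free_elem set \<Rightarrow> 'v::ab_group_add \<Rightarrow> 'v) \<Rightarrow> bool" where
  "nonclassical_rep m scale \<phi> \<longleftrightarrow>
     so_representation m scale \<phi> \<and>
     (\<forall>i\<in>{1..<m}. diagonalizable scale (\<phi> (Ugen m i)) \<and>
        eigenvalues scale (\<phi> (Ugen m i))
          \<subseteq> range (\<lambda>k::nat. (- 1) ^ k * qint qq (2 * int k + 1) / qint qq 2))"

text \<open>\<^const>\<open>Sum_any\<close> is the sum over the support; it is \<open>0\<close> by convention if the support is
  infinite, so finiteness of the support has to be stated separately.\<close>

definition braid_op ::
  "nat \<Rightarrow> (Cq \<Rightarrow> 'v \<Rightarrow> 'v) \<Rightarrow> (free_elem set \<Rightarrow> 'v::ab_group_add \<Rightarrow> 'v) \<Rightarrow> nat \<Rightarrow> 'v \<Rightarrow> 'v" where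
  "braid_op m scale \<phi> i v = Sum_any (\<lambda>k. scale (inverse qq ^ k) (\<phi> (idivpow m i k) v))"


section \<open>The braid group\<close>

text \<open>The letter \<open>(i, True)\<close> stands for the \<open>i\<close>th standard generator, \<open>(i, False)\<close> for its
  inverse.\<close>

type_synonym braid_word = "(nat \<times> bool) list"

definition braid_words :: "nat \<Rightarrow> braid_word set" where
  "braid_words m = lists ({1..<m} \<times> UNIV)"

inductive braid_eq :: "nat \<Rightarrow> braid_word \<Rightarrow> braid_word \<Rightarrow> bool" for m where
  refl: "u \<in> braid_words m \<Longrightarrow> braid_eq m u u"
| sym: "braid_eq m u v \<Longrightarrow> braid_eq m v u"
| trans: "braid_eq m u v \<Longrightarrow> braid_eq m v w \<Longrightarrow> braid_eq m u w"
| app: "braid_eq m u u' \<Longrightarrow> braid_eq m v v' \<Longrightarrow> braid_eq m (u @ v) (u' @ v')"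
| cancel: "i \<in> {1..<m} \<Longrightarrow> braid_eq m [(i, e), (i, \<not> e)] []"
| far: "i \<in> {1..<m} \<Longrightarrow> j \<in> {1..<m} \<Longrightarrow> \<bar>int i - int j\<bar> > 1 \<Longrightarrow>
    braid_eq m [(i, True), (j, True)] [(j, True), (i, True)]"
| braid: "i \<in> {1..<m} \<Longrightarrow> j \<in> {1..<m} \<Longrightarrow> \<bar>int i - int j\<bar> = 1 \<Longrightarrow>
    braid_eq m [(i, True), (j, True), (i, True)] [(j, True), (i, True), (j, True)]"

definition braid_class :: "nat \<Rightarrow> braid_word \<Rightarrow> braid_word set" where
  "braid_class m u = {v. braid_eq m u v}"

definition braid_group :: "nat \<Rightarrow> braid_word set monoid" where
  "braid_group m = \<lparr>carrier = braid_class m ` braid_words m,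
     mult = (\<lambda>A B. {w. \<exists>u\<in>A. \<exists>v\<in>B. braid_eq m (u @ v) w}),
     one = braid_class m []\<rparr>"

definition braid_gen :: "nat \<Rightarrow> nat \<Rightarrow> braid_word set" where
  "braid_gen m i = braid_class m [(i, True)]"

lemma braid_class_eqI: "braid_eq m u v \<Longrightarrow> braid_class m u = braid_class m v"
  unfolding braid_class_def using braid_eq.sym braid_eq.trans by blast

lemma braid_class_mult:
  assumes "u \<in> braid_words m" "v \<in> braid_words m"
  shows "braid_class m u \<otimes>\<^bsub>braid_group m\<^esub> braid_class m v = braid_class m (u @ v)"
  using assms unfolding braid_group_def braid_class_def
  by (auto intro: braid_eq.refl braid_eq.trans braid_eq.app)

lemma braid_word_inverse:
  assumes "u \<in> braid_words m"
  shows "\<exists>v \<in> braid_words m. braid_eq m (v @ u) []"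
  using assms
proof (induction u)
  case Nil
  then show ?case
    by (intro bexI[of _ "[]"]) (auto simp: braid_words_def intro: braid_eq.refl)
next
  case (Cons a u)
  obtain i e where a: "a = (i, e)" by (cases a)
  from Cons.prems have i: "i \<in> {1..<m}" and u: "u \<in> braid_words m"
    by (auto simp: braid_words_def a)
  obtain v where v: "v \<in> braid_words m" "braid_eq m (v @ u) []"
    using Cons.IH[OF u] by blast
  have "braid_eq m ([(i, \<not> e), (i, e)] @ u) ([] @ u)"
    using braid_eq.app[OF braid_eq.cancel[OF i, of "\<not> e"] braid_eq.refl[OF u]] by simp
  then have "braid_eq m (v @ ([(i, \<not> e), (i, e)] @ u)) (v @ ([] @ u))"
    by (rule braid_eq.app[OF braid_eq.refl[OF v(1)]])
  then have "braid_eq m ((v @ [(i, \<not> e)]) @ a # u) []"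
    using v(2) by (auto simp: a intro: braid_eq.trans)
  moreover have "v @ [(i, \<not> e)] \<in> braid_words m"
    using v i by (auto simp: braid_words_def)
  ultimately show ?case by blast
qed

lemma group_braid_group: "group (braid_group m)"
proof (rule groupI)
  have app: "u @ v \<in> braid_words m" if "u \<in> braid_words m" "v \<in> braid_words m" for u v
    using that by (auto simp: braid_words_def)
  have nil: "[] \<in> braid_words m" by (auto simp: braid_words_def)
  have carr: "carrier (braid_group m) = braid_class m ` braid_words m"
    and one: "\<one>\<^bsub>braid_group m\<^esub> = braid_class m []" by (auto simp: braid_group_def)
  show "\<one>\<^bsub>braid_group m\<^esub> \<in> carrier (braid_group m)" using nil by (auto simp: carr one)
  fix x assume "x \<in> carrier (braid_group m)"
  then obtain u where u: "x = braid_class m u" "u \<in> braid_words m" by (auto simp: carr)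
  show "\<one>\<^bsub>braid_group m\<^esub> \<otimes>\<^bsub>braid_group m\<^esub> x = x"
    using nil by (simp add: u one braid_class_mult)
  obtain v where v: "v \<in> braid_words m" "braid_eq m (v @ u) []"
    using braid_word_inverse[OF u(2)] by blast
  show "\<exists>y\<in>carrier (braid_group m). y \<otimes>\<^bsub>braid_group m\<^esub> x = \<one>\<^bsub>braid_group m\<^esub>"
    using v u braid_class_eqI[OF v(2)]
    by (intro bexI[of _ "braid_class m v"]) (auto simp: carr one braid_class_mult)
  fix y assume "y \<in> carrier (braid_group m)"
  then obtain w where w: "y = braid_class m w" "w \<in> braid_words m" by (auto simp: carr)
  show "x \<otimes>\<^bsub>braid_group m\<^esub> y \<in> carrier (braid_group m)"
    using u w app by (auto simp: carr braid_class_mult)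
  fix z assume "z \<in> carrier (braid_group m)"
  then obtain t where "z = braid_class m t" "t \<in> braid_words m" by (auto simp: carr)
  then show "x \<otimes>\<^bsub>braid_group m\<^esub> y \<otimes>\<^bsub>braid_group m\<^esub> z = x \<otimes>\<^bsub>braid_group m\<^esub> (y \<otimes>\<^bsub>braid_group m\<^esub> z)"
    using u w app by (simp add: braid_class_mult)
qed

end

theory Submission
  imports Defs
begin

text \<open>Write \<open>p = -q\<^sup>2\<close> and let \<open>\<lambda>\<^sub>n = (-1)\<^sup>n [2n+1] / [2]\<close> be the admissible eigenvalues. The recursion
  for the divided powers reads \<open>x\<^sup>(\<^sup>k\<^sup>+\<^sup>1\<^sup>) = (-1)\<^sup>k x\<^sup>(\<^sup>k\<^sup>) (b - \<lambda>\<^sub>k) / [k+1]\<close> (the last quantum integer at \<open>q\<^sup>2\<close>),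
  so on the \<open>\<lambda>\<^sub>n\<close>-eigenspace of \<open>b\<close> the sum defining \<open>\<beta>\<close> is a terminating basic hypergeometric series,
  and \<open>q\<close>-Chu-Vandermonde evaluates it to \<open>p\<close> to the power \<open>-n(n+1)/2\<close>.
  If \<open>a\<close> and \<open>b\<close> are adjacent generators, the defining relation shows that \<open>b\<close> shifts the index of
  an \<open>a\<close>-eigenvector by \<open>\<plusminus>1\<close> (or fixes the index \<open>0\<close>). Comparing eigenvalues gives
  \<open>\<beta>\<^sub>a b = (q\<^sup>-\<^sup>1 a b + q b a) \<beta>\<^sub>a\<close> and \<open>\<beta>\<^sub>a (q a b + q\<^sup>-\<^sup>1 b a) = b \<beta>\<^sub>a\<close>. Combining the first with \<open>a\<close>, \<open>b\<close>
  exchanged and the second yields \<open>\<beta>\<^sub>a \<beta>\<^sub>b a = b \<beta>\<^sub>a \<beta>\<^sub>b\<close>, hence \<open>\<beta>\<^sub>a \<beta>\<^sub>b \<beta>\<^sub>a = \<beta>\<^sub>b \<beta>\<^sub>a \<beta>\<^sub>b\<close>, as \<open>\<beta>\<^sub>a\<close> and \<open>\<beta>\<^sub>b\<close> are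
  the same function of \<open>a\<close> and \<open>b\<close>.\<close>

section \<open>A terminating \<open>q\<close>-Chu-Vandermonde sum\<close>

text \<open>The \<open>k\<close>-th term of \<open>\<^sub>2\<phi>\<^sub>1(r\<^sup>-\<^sup>n, r\<^sup>n\<^sup>+\<^sup>1; -r; r, r)\<close>.\<close>

definition vterm :: "'a::field \<Rightarrow> nat \<Rightarrow> nat \<Rightarrow> 'a" where
  "vterm r n k = (\<Prod>j<k. r * (1 - r ^ j / r ^ n) * (1 - r ^ (n + 1 + j)) / (1 - r ^ (2 * j + 2)))"

lemma vterm_0 [simp]: "vterm r n 0 = 1"
  by (simp add: vterm_def)

lemma vterm_Suc: "vterm r n (Suc k) =
    r * (1 - r ^ k / r ^ n) * (1 - r ^ (n + 1 + k)) / (1 - r ^ (2 * k + 2)) * vterm r n k"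
  by (simp add: vterm_def)

lemma vterm_eq_0: "r \<noteq> 0 \<Longrightarrow> n < k \<Longrightarrow> vterm r n k = 0"
  by (auto simp: vterm_def intro!: bexI[of _ n])

text \<open>Raising \<open>n\<close> shifts both numerator progressions by one place, so the two
  products agree up to factors at the ends. The quotient of \<open>1 - 1 / r ^ (n + 1)\<close> by
  \<open>1 - r ^ (n + 1)\<close> gives the sign and the power of \<open>r\<close>.\<close>

lemma vterm_Suc_Suc:
  fixes r :: "'a::field"
  assumes r: "r \<noteq> 0" "\<forall>k>0. r ^ k \<noteq> 1"
  shows "vterm r (Suc n) (Suc m) =
    - ((1 - r ^ (n + 1 + m)) * (1 - r ^ (n + 2 + m)) / (r ^ n * (1 - r ^ (2 * m + 2)))) * vterm r n m"
proof (induction m)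
  case 0
  have "1 - r ^ 2 \<noteq> 0" using r(2)[rule_format, of 2] by simp
  then show ?case using r(1) by (simp add: vterm_Suc field_simps power2_eq_square)
next
  case (Suc m)
  define N K where "N = r ^ n" and "K = r ^ m"
  have nz: "N \<noteq> 0" "K \<noteq> 0" using r by (auto simp: N_def K_def)
  have d: "1 - r^2 * K^2 \<noteq> 0" "1 - r^4 * K^2 \<noteq> 0"
    using r(2)[rule_format, of "2 + m * 2"] r(2)[rule_format, of "4 + m * 2"] by (simp_all add: K_def flip: power_add power_mult)
  have e: "r ^ (Suc n + 1 + Suc m) = r^3 * N * K" "r ^ (n + 1 + Suc m) = r^2 * N * K"
    "r ^ (n + 2 + Suc m) = r^3 * N * K" "r ^ (n + 1 + m) = r * N * K" "r ^ (n + 2 + m) = r^2 * N * K"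
    "r ^ (2 * m + 2) = r^2 * K^2" "r ^ (2 * Suc m + 2) = r^4 * K^2" "r ^ Suc m = r * K" "r ^ Suc n = r * N"
    "r ^ n = N" "r ^ m = K"
    by (simp_all add: N_def K_def power_add power_mult power2_eq_square power_mult_distrib eval_nat_numeral)
  show ?case
    unfolding vterm_Suc[of r "Suc n" "Suc m"] Suc.IH vterm_Suc[of r n m] e
    using nz d r(1) by (simp add: divide_simps)
qed

text \<open>Creative telescoping: \<open>vterm r (Suc n) k - r ^ Suc n * vterm r n k\<close> is the
  increment in \<open>k\<close> of the boundary term on the right. That term vanishes once
  \<open>m > n\<close>, which leaves a recursion in \<open>n\<close> alone.\<close>

lemma sum_vterm_Suc:
  fixes r :: "'a::field"
  assumes r: "r \<noteq> 0" "\<forall>k>0. r ^ k \<noteq> 1"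
  shows "(\<Sum>k\<le>m. vterm r (Suc n) k) =
    r ^ Suc n * (\<Sum>k\<le>m. vterm r n k) + vterm r n m * (1 / r ^ m - r ^ Suc n)"
proof (induction m)
  case (Suc m)
  define N K where "N = r ^ n" and "K = r ^ m"
  have nz: "N \<noteq> 0" "K \<noteq> 0" using r by (auto simp: N_def K_def)
  have d: "1 - r^2 * K^2 \<noteq> 0"
    using r(2)[rule_format, of "2 + m * 2"] by (simp_all add: K_def flip: power_add power_mult)
  have e: "r ^ (n + 1 + m) = r * N * K" "r ^ (n + 2 + m) = r^2 * N * K"
    "r ^ (2 * m + 2) = r^2 * K^2" "r ^ Suc m = r * K" "r ^ Suc n = r * N"
    "r ^ n = N" "r ^ m = K"
    by (simp_all add: N_def K_def power_add power_mult power2_eq_square power_mult_distrib eval_nat_numeral)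
  have "vterm r (Suc n) (Suc m) = vterm r n (Suc m) * (1 / r ^ Suc m) - vterm r n m * (1 / r ^ m - r ^ Suc n)"
    unfolding vterm_Suc_Suc[OF r] vterm_Suc[of r n m] e
    using nz d r(1) by (simp add: divide_simps) (simp add: algebra_simps power2_eq_square)
  then show ?case unfolding sum.atMost_Suc Suc.IH by (simp add: algebra_simps)
qed (simp add: algebra_simps)

lemma sum_vterm:
  fixes r :: "'a::field"
  assumes r: "r \<noteq> 0" "\<forall>k>0. r ^ k \<noteq> 1" and "n \<le> m"
  shows "(\<Sum>k\<le>m. vterm r n k) = (\<Prod>i\<le>n. r ^ i)"
  using \<open>n \<le> m\<close>
proof (induction n)
  case 0
  have "(\<Sum>k\<le>m. vterm r 0 k) = (\<Sum>k\<in>{0}. vterm r 0 k)"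
    by (rule sum.mono_neutral_right) (use vterm_eq_0[OF r(1), of 0] in auto)
  then show ?case by simp
next
  case (Suc n)
  then show ?case by (simp add: sum_vterm_Suc[OF r] vterm_eq_0[OF r(1)])
qed

section \<open>The nonclassical eigenvalues\<close>

text \<open>This is \<open>(-1)\<^sup>n [2n+1] / [2]\<close>, written in terms of \<open>p\<^sup>n\<close> for \<open>p = -q\<^sup>2\<close>.\<close>

definition eigval :: "'a::field \<Rightarrow> nat \<Rightarrow> 'a" where
  "eigval q n = (q * (- (q^2)) ^ n - inverse (q * (- (q^2)) ^ n)) / (q^2 - inverse (q^2))"

context
  fixes q :: "'a::field"
  assumes q: "q \<noteq> 0" "\<forall>k>0. q ^ k \<noteq> 1"
begin

lemma q4_neq_1: "q^4 \<noteq> 1" and q2_diff: "q^2 - inverse (q^2) \<noteq> 0"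
proof -
  show *: "q^4 \<noteq> 1" using q(2)[rule_format, of 4] by simp
  show "q^2 - inverse (q^2) \<noteq> 0"
  proof
    assume "q^2 - inverse (q^2) = 0"
    then have "q^2 * q^2 = 1" using q(1) by (simp add: field_simps)
    with * show False by (simp add: power2_eq_square power4_eq_xxxx mult.assoc)
  qed
qed

lemma eigval_0: "q * eigval q 0 + inverse q * eigval q 0 = 1"
proof -
  have "eigval q 0 * (q^2 - inverse (q^2)) = q - inverse q"
    using q2_diff by (simp add: eigval_def)
  then have "(q * eigval q 0 + inverse q * eigval q 0) * (q^2 - inverse (q^2))
      = (q + inverse q) * (q - inverse q)"
    by (metis distrib_right mult.assoc)
  also have "\<dots> = 1 * (q^2 - inverse (q^2))"
    by (simp add: algebra_simps power2_eq_square)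
  finally show ?thesis using q2_diff by (metis mult_right_cancel)
qed

text \<open>If \<open>f n\<close> is the scalar by which \<open>\<beta>\<close> acts on the
  \<open>n\<close>-th eigenspace, the right-hand sides are \<open>f (Suc n) / f n\<close> and its
  inverse. \<open>eigval_pred\<close> is the counterpart for the lower neighbour.\<close>

lemma eigval_Suc:
  shows "inverse q * eigval q (Suc n) + q * eigval q n = inverse ((- (q^2)) ^ Suc n)"
    and "q * eigval q (Suc n) + inverse q * eigval q n = (- (q^2)) ^ Suc n"
proof -
  define P where "P = (- (q^2)) ^ n"
  have P: "P \<noteq> 0" using q by (simp add: P_def)
  define D where "D = q^2 - inverse (q^2)"
  have D: "D \<noteq> 0" using q2_diff by (simp add: D_def)
  have e: "eigval q n = (q * P - inverse (q * P)) / D"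
    "eigval q (Suc n) = (q * (- (q^2)*P) - inverse (q * (- (q^2)*P))) / D" by (simp_all add: eigval_def P_def D_def)
  have "inverse q * (q * (- (q^2)*P) - inverse (q * (- (q^2)*P))) + q * (q * P - inverse (q * P))
    = D * inverse (-(q^2)*P)" unfolding D_def using P q(1) by (simp add: divide_simps) (simp add: algebra_simps eval_nat_numeral)
  then show "inverse q * eigval q (Suc n) + q * eigval q n = inverse ((- (q^2)) ^ Suc n)"
    unfolding e using D by (simp add: P_def[symmetric] flip: add_divide_distrib)
  have "q * (q * (- (q^2)*P) - inverse (q * (- (q^2)*P))) + inverse q * (q * P - inverse (q * P))
    = D * (-(q^2)*P)" unfolding D_def using P q(1) by (simp add: divide_simps) (simp add: algebra_simps eval_nat_numeral)
  then show "q * eigval q (Suc n) + inverse q * eigval q n = (- (q^2)) ^ Suc n"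
    unfolding e using D by (simp add: P_def[symmetric] flip: add_divide_distrib)
qed


text \<open>The truncation \<open>0 - 1 = 0\<close> is intended here and below: the formula for \<open>eigval q n\<close> takes the
  same value at \<open>n = -1\<close> and at \<open>n = 0\<close>.\<close>

lemma eigval_pred:
  shows "inverse q * eigval q (n - 1) + q * eigval q n = (- (q^2)) ^ n"
    and "q * eigval q (n - 1) + inverse q * eigval q n = inverse ((- (q^2)) ^ n)"
  using eigval_0 eigval_Suc[of "n - 1"] by (cases n; simp add: add.commute)+

text \<open>The two neighbours of \<open>l = eigval q n\<close> are the roots of
  \<open>X^2 + (q^2 + q^-2) l X + l^2 - 1\<close>, the polynomial in \<open>A\<close> that the
  defining relation produces on an \<open>l\<close>-eigenvector. Distinct roots allow the splitting
  into eigenvectors.\<close>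

lemma eigval_neighbours:
  shows "eigval q (Suc n) + eigval q (n - 1) = - (q^2 + inverse (q^2)) * eigval q n" (is ?sum)
    and "eigval q (Suc n) * eigval q (n - 1) = eigval q n ^ 2 - 1" (is ?prod)
    and "eigval q (Suc n) \<noteq> eigval q (n - 1)" (is ?neq)
proof -
  define P l l' l'' where "P = (- (q^2)) ^ n" and "l = eigval q n" and "l' = eigval q (Suc n)" and "l'' = eigval q (n - 1)"
  have P: "P \<noteq> 0" using q by (simp add: P_def)
  have "inverse q * l' + q * l = inverse (- (q^2) * P)"
    using eigval_Suc(1)[of n] by (simp add: P_def l_def l'_def)
  then have "inverse q * l' = inverse (- (q^2) * P) - q * l" by (simp add: algebra_simps)
  moreover have "l' = q * (inverse q * l')" using q(1) by simp
  ultimately have "l' = q * (inverse (- (q^2) * P) - q * l)" by simp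
  also have "\<dots> = - (1 / (q * P)) - q^2 * l"
    using q(1) P by (simp add: field_simps power2_eq_square)
  finally have l': "l' = - (1 / (q * P)) - q^2 * l" .
  have "inverse q * l'' + q * l = P"
    using eigval_pred(1)[of n] by (simp add: P_def l_def l''_def)
  then have l'': "l'' = q * P - q^2 * l"
    using q P by (simp add: field_simps power2_eq_square)
  have l: "q^2 * l - l / q^2 = q * P - 1 / (q * P)"
  proof -
    have "l * (q^2 - inverse (q^2)) = q * P - inverse (q * P)"
      using q2_diff by (simp add: l_def eigval_def P_def)
    then show ?thesis by (simp add: right_diff_distrib divide_inverse mult.commute)
  qed
  show ?sum
    unfolding l_def[symmetric] l'_def[symmetric] l''_def[symmetric] l' l'' using l
    by (simp add: field_simps)
  \<comment> \<open>The last summand is zero by \<open>l\<close>; it isolates the only place where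
    the value of \<open>l\<close> enters.\<close>
  have "l' * l'' = l ^ 2 - 1 + q^2 * l * ((q^2 * l - l / q^2) - (q * P - 1 / (q * P)))"
    unfolding l' l'' using q P by (simp add: field_simps power2_eq_square)
  then show ?prod
    unfolding l_def[symmetric] l'_def[symmetric] l''_def[symmetric] l by simp
  show ?neq
  proof
    assume "eigval q (Suc n) = eigval q (n - 1)"
    then have "q^2 * P^2 = - 1" using l' l'' q P unfolding l'_def[symmetric] l''_def[symmetric]
      by (simp add: field_simps power2_eq_square)
    moreover have "(q^2 * P^2)^2 = q^4 * P^4" by (simp add: power_mult_distrib flip: power_mult)
    ultimately have "q^4 * P^4 = 1" by simp
    moreover have "q^4 * P^4 = q ^ (4 + 8 * n)"
      by (simp add: P_def power_add power_mult_distrib flip: power_mult)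
    ultimately show False using q(2)[rule_format, of "4 + 8 * n"] by simp
  qed
qed

text \<open>The left side is the scalar by which the weighted recursion for divided powers passes
  from index \<open>j\<close> to \<open>j + 1\<close> on an \<open>eigval q n\<close>-eigenvector;
  the quotient in it is \<open>1 / [j+1]\<close> at \<open>q^2\<close>. With
  \<open>r = -q^-2\<close> the signs are absorbed into powers of \<open>r\<close>.\<close>

lemma vterm_step:
  "inverse q * ((- 1) ^ j * ((q^2 - inverse (q^2)) / ((q^2) ^ Suc j - inverse ((q^2) ^ Suc j))))
      * (eigval q n - eigval q j) =
    (let r = inverse (- (q^2)) in r * (1 - r ^ j / r ^ n) * (1 - r ^ (n + 1 + j)) / (1 - r ^ (2 * j + 2)))"
proof -
  define P J where "P = (- (q^2)) ^ n" and "J = (- (q^2)) ^ j"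
  define D where "D = q^2 - inverse (q^2)"
  have P: "P \<noteq> 0" and J: "J \<noteq> 0" using q by (simp_all add: P_def J_def)
  have D: "D \<noteq> 0" using q2_diff by (simp add: D_def)
  have "J ^ 2 = ((- (q^2)) ^ 2) ^ j" unfolding J_def by (metis mult.commute power_mult)
  then have JJ: "J ^ 2 = q ^ (4 * j)" by (simp add: power_mult)
  have "q^4 * J^2 = q ^ (4 + 4 * j)"
    by (simp add: JJ power_add flip: power_mult)
  then have d: "q^4 * J^2 - 1 \<noteq> 0" using q(2)[rule_format, of "4 + 4 * j"] by auto
  have s: "(q^2) ^ Suc j = (- 1) ^ j * q^2 * J" by (simp add: J_def power_mult flip: power_mult_distrib)
  have s': "(q^2) ^ Suc j - inverse ((q^2) ^ Suc j) = (- 1) ^ j * (q^2 * J - inverse (q^2 * J))"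
    unfolding s by (cases "even j") auto
  define X Z where "X = (q * P - inverse (q * P)) - (q * J - inverse (q * J))"
    and "Z = q^2 * J - inverse (q^2 * J)"
  have Z: "Z = (q^4 * J^2 - 1) / (q^2 * J)"
    using q J by (simp add: Z_def field_simps power2_eq_square power4_eq_xxxx)
  have e: "eigval q n - eigval q j = X / D"
    by (simp add: X_def eigval_def P_def J_def D_def diff_divide_distrib)
  have "(- 1) ^ j * (D / ((- 1) ^ j * Z)) = D / Z" by simp
  then have "inverse q * ((- 1) ^ j * (D / ((- 1) ^ j * Z))) * (eigval q n - eigval q j) = inverse q * X / Z"
    unfolding e using D by simp
  also have "inverse q * X / Z
    = inverse (- (q^2)) * (1 - P / J) * (1 + inverse (q^2 * P * J)) / (1 - inverse (q^4 * J^2))"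
    unfolding X_def Z using q P J d by (simp add: divide_simps) (simp add: algebra_simps eval_nat_numeral)
  finally have *: "inverse q * ((- 1) ^ j * (D / ((- 1) ^ j * Z))) * (eigval q n - eigval q j) =
    inverse (- (q^2)) * (1 - P / J) * (1 + inverse (q^2 * P * J)) / (1 - inverse (q^4 * J^2))" .
  define r where "r = inverse (- (q^2))"
  have r: "r ^ j = inverse J" "r ^ n = inverse P"
    by (simp_all only: r_def P_def J_def power_inverse)
  have "r ^ (n + 1 + j) = - inverse (q^2 * P * J)"
    by (simp add: power_add r) (simp add: r_def)
  moreover have "r ^ (2 * j + 2) = inverse (q^4 * J^2)"
    by (simp add: power_add mult.commute[of 2 j] power_mult r)
      (simp add: r_def power2_eq_square power4_eq_xxxx)
  moreover have "r ^ j / r ^ n = P / J" by (simp add: r divide_inverse)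
  ultimately show ?thesis
    using * unfolding Let_def s' D_def[symmetric] Z_def[symmetric] r_def[symmetric] by simp
qed

end

section \<open>Operators with prescribed eigenvalues\<close>

text \<open>\<open>A\<close> is diagonalizable with eigenvalues in the range of \<open>lam\<close>, and \<open>T\<close> is the function of \<open>A\<close>
  sending \<open>lam n\<close> to \<open>f n\<close>.\<close>

definition (in vector_space) spectral_op ::
  "(nat \<Rightarrow> 'a) \<Rightarrow> (nat \<Rightarrow> 'a) \<Rightarrow> ('b \<Rightarrow> 'b) \<Rightarrow> ('b \<Rightarrow> 'b) \<Rightarrow> bool" where
  "spectral_op lam f A T \<longleftrightarrow>
     Vector_Spaces.linear scale scale A \<and> Vector_Spaces.linear scale scale T \<and>
     span {v. \<exists>n. A v = scale (lam n) v} = UNIV \<and>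
     (\<forall>n v. A v = scale (lam n) v \<longrightarrow> T v = scale (f n) v)"

context vector_space
begin

lemma linear_eq_on_spanning_set:
  assumes "Vector_Spaces.linear scale scale F" "Vector_Spaces.linear scale scale G"
    and "span S = UNIV" and "\<And>v. v \<in> S \<Longrightarrow> F v = G v"
  shows "F v = G v"
proof -
  interpret F: Vector_Spaces.linear scale scale F by fact
  interpret G: Vector_Spaces.linear scale scale G by fact
  have "v \<in> span S" using assms(3) by simp
  then show ?thesis
    by (induction rule: span_induct_alt) (simp_all add: F.add G.add F.scale G.scale F.zero G.zero assms(4))
qed

text \<open>\<open>W\<close> maps eigenvectors of \<open>A\<close> to eigenvectors of
  \<open>A'\<close> for the same eigenvalue (or to zero), where \<open>T\<close> and
  \<open>T'\<close> are the same scalar.\<close>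

lemma spectral_op_intertwine:
  assumes AT: "spectral_op lam f A T" and AT': "spectral_op lam f A' T'"
    and W: "Vector_Spaces.linear scale scale W" and WA: "\<And>v. W (A v) = A' (W v)"
  shows "W (T v) = T' (W v)"
proof -
  interpret W: Vector_Spaces.linear scale scale W by fact
  have "(W \<circ> T) v = (T' \<circ> W) v"
  proof (rule linear_eq_on_spanning_set[where F = "W \<circ> T" and G = "T' \<circ> W"])
    show "Vector_Spaces.linear scale scale (W \<circ> T)" "Vector_Spaces.linear scale scale (T' \<circ> W)"
      using W AT AT' by (auto simp: spectral_op_def Vector_Spaces.linear_iff)
    show "span {v. \<exists>n. A v = scale (lam n) v} = UNIV" using AT by (simp add: spectral_op_def)
    fix v assume "v \<in> {v. \<exists>n. A v = scale (lam n) v}"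
    then obtain n where n: "A v = scale (lam n) v" by blast
    then have "A' (W v) = scale (lam n) (W v)" by (simp add: W.scale flip: WA)
    then have "T' (W v) = scale (f n) (W v)" using AT' by (simp add: spectral_op_def)
    moreover have "T v = scale (f n) v" using AT n by (simp add: spectral_op_def)
    ultimately show "(W \<circ> T) v = (T' \<circ> W) v" by (simp add: W.scale)
  qed
  then show ?thesis by simp
qed

text \<open>The range contains every eigenvector. Injectivity will come from finite
  dimension.\<close>

lemma spectral_op_surj:
  assumes AT: "spectral_op lam f A T" and nz: "\<And>n. f n \<noteq> 0"
  shows "surj T"
proof -
  interpret T: Vector_Spaces.linear scale scale T using AT by (simp add: spectral_op_def)
  have "{v. \<exists>n. A v = scale (lam n) v} \<subseteq> range T"
  proof clarify
    fix v n assume "A v = scale (lam n) v"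
    then have "T v = scale (f n) v" using AT by (simp add: spectral_op_def)
    then have "T (scale (inverse (f n)) v) = v" using nz by (simp add: T.scale)
    then show "v \<in> range T" by (metis rangeI)
  qed
  moreover have "subspace (range T)" by (rule T.subspace_image) simp
  ultimately have "span {v. \<exists>n. A v = scale (lam n) v} \<subseteq> range T" by (rule span_minimal)
  then show ?thesis using AT by (auto simp: spectral_op_def)
qed

text \<open>On an eigenvector of \<open>A\<close>, both sides decompose along the two neighbouring
  eigenspaces, and each component is one of the scalar identities \<open>eigval_Suc\<close> and
  \<open>eigval_pred\<close>.\<close>

lemma spectral_op_twist:
  fixes q :: 'a
  assumes q: "q \<noteq> 0" "\<forall>k>0. q ^ k \<noteq> 1"
    and AT: "spectral_op (eigval q) (\<lambda>n. \<Prod>i\<le>n. inverse (- (q^2)) ^ i) A T"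
    and B: "Vector_Spaces.linear scale scale B"
    and rel: "\<And>v. A (A (B v)) + B (A (A v)) = scale (- (q^2 + inverse (q^2))) (A (B (A v))) + B v"
  shows "T (B v) = scale (inverse q) (A (B (T v))) + scale q (B (A (T v)))"
    and "T (scale q (A (B v)) + scale (inverse q) (B (A v))) = B (T v)"
proof -
  interpret A: Vector_Spaces.linear scale scale A using AT by (simp add: spectral_op_def)
  interpret T: Vector_Spaces.linear scale scale T using AT by (simp add: spectral_op_def)
  interpret B: Vector_Spaces.linear scale scale B by fact
  define f where "f = (\<lambda>n. \<Prod>i\<le>n. inverse (- (q^2)) ^ i)"
  have f_Suc: "f (Suc n) = f n * inverse ((- (q^2)) ^ Suc n)" for n
    by (simp only: f_def prod.atMost_Suc power_inverse)
  \<comment> \<open>The exponent \<open>n(n+1)/2\<close> also agrees at \<open>-1\<close> and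
    \<open>0\<close>, so truncated subtraction is right for \<open>f\<close> too.\<close>
  have f_pred: "f (n - 1) = f n * (- (q^2)) ^ n" for n
    using f_Suc[of "n - 1"] q(1) by (cases n) (simp_all add: field_simps)
  have span: "span {v. \<exists>n. A v = scale (eigval q n) v} = UNIV" using AT by (simp add: spectral_op_def)
  have Tf: "T v = scale (f n) v" if "A v = scale (eigval q n) v" for v n
    using AT that by (simp add: spectral_op_def f_def)
  \<comment> \<open>By the relation, \<open>B\<close> maps the \<open>n\<close>-th eigenspace of \<open>A\<close> into the sum of its two neighbours.\<close>
  have main: "T (B v) = scale (inverse q) (A (B (T v))) + scale q (B (A (T v))) \<and>
     T (scale q (A (B v)) + scale (inverse q) (B (A v))) = B (T v)"
    if v: "A v = scale (eigval q n) v" for v n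
  proof -
    define l l' l'' where "l = eigval q n" and "l' = eigval q (Suc n)" and "l'' = eigval q (n - 1)"
    define w where "w = B v"
    note nb = eigval_neighbours[OF q, of n, folded l_def l'_def l''_def]
    \<comment> \<open>That is, \<open>(A - l') (A - l'')\<close> kills \<open>w\<close>.\<close>
    have AAw: "A (A w) = scale (l' + l'') (A w) - scale (l' * l'') w"
    proof -
      have "A (A w) + scale (l * l) w = scale (- (q^2 + inverse (q^2)) * l) (A w) + w"
        using rel[of v] by (simp add: v A.scale B.scale flip: w_def l_def)
      then have "A (A w) = scale (- (q^2 + inverse (q^2)) * l) (A w) + w - scale (l * l) w"
        by (simp add: eq_diff_eq)
      then show ?thesis unfolding nb by (simp add: power2_eq_square scale_left_diff_distrib)
    qed
    define c where "c = inverse (l' - l'')"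
    have c: "c * (l' - l'') = 1" using nb(3) by (simp add: c_def)
    \<comment> \<open>Lagrange interpolation at the roots \<open>l'\<close> and \<open>l''\<close>
      gives the projections of \<open>w\<close> to the two eigenspaces.\<close>
    define w1 w2 where "w1 = scale c (A w - scale l'' w)" and "w2 = scale c (scale l' w - A w)"
    have "w1 + w2 = scale (c * (l' - l'')) w"
      by (simp add: w1_def w2_def scale_right_diff_distrib scale_left_diff_distrib algebra_simps)
    then have w: "w = w1 + w2" by (simp add: c)
    have w1: "A w1 = scale l' w1"
      by (simp add: w1_def A.scale A.diff AAw scale_right_diff_distrib scale_left_distrib algebra_simps)
    have w2: "A w2 = scale l'' w2"
      by (simp add: w2_def A.scale A.diff AAw scale_right_diff_distrib scale_left_distrib algebra_simps)
    have Tw: "T w1 = scale (f (Suc n)) w1" "T w2 = scale (f (n - 1)) w2"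
      using Tf w1 w2 by (auto simp: l'_def l''_def)
    have Tv: "T v = scale (f n) v" using Tf v by simp
    have P: "(- (q^2)) ^ k \<noteq> 0" for k using q by simp
    have "T (B v) = scale (f (Suc n)) w1 + scale (f (n - 1)) w2"
      by (simp add: T.add Tw w flip: w_def)
    also have "\<dots> = scale (f n * (inverse q * l' + q * l)) w1 + scale (f n * (inverse q * l'' + q * l)) w2"
      using eigval_Suc(1)[OF q, of n] eigval_pred(1)[OF q, of n]
      by (simp only: f_Suc[of n] f_pred[of n] l_def l'_def l''_def)
    also have "\<dots> = scale (inverse q) (A (B (T v))) + scale q (B (A (T v)))"
      by (simp add: Tv v A.scale B.scale A.add w w1 w2 scale_left_distrib scale_right_distrib algebra_simps flip: w_def l_def)
    finally have 1: "T (B v) = scale (inverse q) (A (B (T v))) + scale q (B (A (T v)))" .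
    have "T (scale q (A (B v)) + scale (inverse q) (B (A v))) =
        scale (f (Suc n) * (q * l' + inverse q * l)) w1 + scale (f (n - 1) * (q * l'' + inverse q * l)) w2"
      by (simp add: v A.scale B.scale T.scale A.add T.add Tw w w1 w2 scale_left_distrib scale_right_distrib algebra_simps flip: w_def l_def)
    also have "\<dots> = scale (f n) w1 + scale (f n) w2"
      using eigval_Suc(2)[OF q, of n] eigval_pred(2)[OF q, of n]
      by (simp only: f_Suc[of n] f_pred[of n] l_def l'_def l''_def mult.assoc
          left_inverse[OF P] right_inverse[OF P] mult_1_right)
    also have "\<dots> = B (T v)"
      by (simp add: Tv B.scale w scale_right_distrib flip: w_def)
    finally show ?thesis using 1 by simp
  qed
  have lin: "Vector_Spaces.linear scale scale A" "Vector_Spaces.linear scale scale T" by unfold_locales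
  show "T (B v) = scale (inverse q) (A (B (T v))) + scale q (B (A (T v)))"
  proof (rule linear_eq_on_spanning_set[where F = "\<lambda>v. T (B v)"
      and G = "\<lambda>v. scale (inverse q) (A (B (T v))) + scale q (B (A (T v)))", OF _ _ span])
    show "Vector_Spaces.linear scale scale (\<lambda>v. T (B v))"
      "Vector_Spaces.linear scale scale (\<lambda>v. scale (inverse q) (A (B (T v))) + scale q (B (A (T v))))"
      by (auto simp: Vector_Spaces.linear_iff vector_space_axioms A.add B.add T.add A.scale B.scale T.scale algebra_simps)
  qed (use main in blast)
  show "T (scale q (A (B v)) + scale (inverse q) (B (A v))) = B (T v)"
  proof (rule linear_eq_on_spanning_set[where G = "\<lambda>v. B (T v)"
      and F = "\<lambda>v. T (scale q (A (B v)) + scale (inverse q) (B (A v)))", OF _ _ span])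
    show "Vector_Spaces.linear scale scale (\<lambda>v. B (T v))"
      "Vector_Spaces.linear scale scale (\<lambda>v. T (scale q (A (B v)) + scale (inverse q) (B (A v))))"
      by (auto simp: Vector_Spaces.linear_iff vector_space_axioms A.add B.add T.add A.scale B.scale T.scale algebra_simps)
  qed (use main in blast)
qed

lemma spectral_op_braid:
  fixes q :: 'a
  assumes q: "q \<noteq> 0" "\<forall>k>0. q ^ k \<noteq> 1"
    and AT: "spectral_op (eigval q) (\<lambda>n. \<Prod>i\<le>n. inverse (- (q^2)) ^ i) A T"
    and BU: "spectral_op (eigval q) (\<lambda>n. \<Prod>i\<le>n. inverse (- (q^2)) ^ i) B U"
    and AB: "\<And>v. A (A (B v)) + B (A (A v)) = scale (- (q^2 + inverse (q^2))) (A (B (A v))) + B v"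
    and BA: "\<And>v. B (B (A v)) + A (B (B v)) = scale (- (q^2 + inverse (q^2))) (B (A (B v))) + A v"
  shows "T (U (T v)) = U (T (U v))"
proof -
  have lin: "Vector_Spaces.linear scale scale A" "Vector_Spaces.linear scale scale B"
    "Vector_Spaces.linear scale scale T" "Vector_Spaces.linear scale scale U"
    using AT BU by (auto simp: spectral_op_def)
  \<comment> \<open>The first twist identity, with the generators exchanged, turns
    \<open>U (A v)\<close> into the very argument of \<open>T\<close> in the second one, taken at
    \<open>U v\<close>.\<close>
  have "T (U (A v)) = B (T (U v))" for v
    using spectral_op_twist(1)[OF q BU lin(1) BA, of v] spectral_op_twist(2)[OF q AT lin(2) AB, of "U v"]
    by (simp add: add.commute)
  \<comment> \<open>Now \<open>T \<circ> U\<close> intertwines \<open>A\<close> with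
    \<open>B\<close>, hence also \<open>T\<close> with \<open>U\<close>.\<close>
  then show ?thesis
    using spectral_op_intertwine[OF AT BU, of "T \<circ> U" v] lin(3,4) Vector_Spaces.linear_compose by fastforce
qed

text \<open>A function of an operator commutes with whatever commutes with that operator; this is
  applied first to \<open>T\<close>, then to \<open>U\<close>.\<close>

lemma spectral_op_commute:
  assumes AT: "spectral_op lam f A T" and BU: "spectral_op lam f B U"
    and AB: "\<And>v. A (B v) = B (A v)"
  shows "T (U v) = U (T v)"
proof -
  have lin: "Vector_Spaces.linear scale scale B" "Vector_Spaces.linear scale scale T"
    using AT BU by (auto simp: spectral_op_def)
  have "T (B v) = B (T v)" for v
    using spectral_op_intertwine[OF AT AT lin(1)] AB by simp
  then show ?thesis
    using spectral_op_intertwine[OF BU BU lin(2)] by simp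
qed

end


section \<open>Quantum integers\<close>

lemma qq_neq_0: "qq \<noteq> 0"
  by (simp add: qq_def Zero_fract_def eq_fract)

lemma qq_power_neq_1: "\<forall>k>0. qq ^ k \<noteq> 1"
proof clarify
  fix k :: nat assume "k > 0" "qq ^ k = 1"
  have "qq ^ k = Fraction_Field.Fract ([:0, 1:] ^ k) 1" for k
    by (induction k) (simp_all add: qq_def One_fract_def)
  with \<open>qq ^ k = 1\<close> have "[:0, 1:] ^ k = (1 :: complex poly)"
    by (simp add: One_fract_def eq_fract)
  then have "degree ([:0, 1:] ^ k :: complex poly) = 0" by simp
  with \<open>k > 0\<close> show False by (simp add: degree_power_eq)
qed

lemmas qq = qq_neq_0 qq_power_neq_1

text \<open>Admits \<open>r = -q^-2\<close> in the summation formula; squaring removes the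
  sign.\<close>

lemma inverse_mqq2: "inverse (- (qq^2)) \<noteq> 0" "\<forall>k>0. inverse (- (qq^2)) ^ k \<noteq> 1"
proof -
  show "inverse (- (qq^2)) \<noteq> 0" by (simp add: qq_neq_0)
  show "\<forall>k>0. inverse (- (qq^2)) ^ k \<noteq> 1"
  proof clarify
    fix k :: nat assume k: "k > 0" and "inverse (- (qq^2)) ^ k = 1"
    then have "(- (qq^2)) ^ k = 1" by (simp only: power_inverse inverse_eq_1_iff)
    then have "((- (qq^2)) ^ k) ^ 2 = 1" by simp
    moreover have "((- (qq^2)) ^ k) ^ 2 = qq ^ (4 * k)"
    proof -
      have "((- (qq^2)) ^ k) ^ 2 = ((- (qq^2)) ^ 2) ^ k" by (metis mult.commute power_mult)
      then show ?thesis by (simp add: power_mult)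
    qed
    ultimately show False using qq_power_neq_1 k by simp
  qed
qed

lemma qq_diff: "qq - inverse qq \<noteq> 0"
proof
  assume "qq - inverse qq = 0"
  then have "qq ^ 2 = 1" using qq_neq_0 by (simp add: field_simps power2_eq_square)
  then show False using qq_power_neq_1 by simp
qed

lemma qint_2_neq_0: "qint qq 2 \<noteq> 0"
  using q2_diff[OF qq] qq_diff by (simp add: qint_def power_int_minus)

lemma qint_2_mult: "qint qq 2 * qint qq k = qint qq (k + 1) + qint qq (k - 1)"
proof -
  have e: "qq powi (k + 1) = qq powi k * qq" "qq powi (k - 1) = qq powi k / qq"
    "qq powi (- (k + 1)) = qq powi (- k) / qq" "qq powi (- (k - 1)) = qq powi (- k) * qq"
    using qq_neq_0 power_int_add[of qq k 1] power_int_diff[of qq k 1]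
      power_int_diff[of qq "-k" 1] power_int_add[of qq "-k" 1] by simp_all
  have two: "qint qq 2 = qq + inverse qq"
  proof -
    have "qq ^ 2 - inverse (qq ^ 2) = (qq + inverse qq) * (qq - inverse qq)"
      by (simp add: algebra_simps power2_eq_square qq_neq_0)
    then show ?thesis using qq_diff by (simp add: qint_def power_int_minus)
  qed
  have "(qq + inverse qq) * (qq powi k - qq powi (- k)) =
    (qq powi (k + 1) - qq powi (- (k + 1))) + (qq powi (k - 1) - qq powi (- (k - 1)))"
    unfolding e by (simp add: divide_inverse algebra_simps)
  then show ?thesis unfolding two
    by (simp add: qint_def flip: add_divide_distrib)
qed

lemma qint_odd: "qint qq (2 * int n + 1) / qint qq 2 = (- 1) ^ n * eigval qq n"
proof -
  have "qq powi (2 * int n + 1) = (qq^2) ^ n * qq"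
  proof -
    have "2 * int n + 1 = int (2 * n + 1)" by simp
    then show ?thesis by (simp only: power_int_of_nat) (simp add: power_add power_mult)
  qed
  moreover have "qq powi (- (2 * int n + 1)) = inverse (qq powi (2 * int n + 1))"
    by (simp only: power_int_minus)
  moreover have "(- (qq^2)) ^ n = (- 1) ^ n * (qq^2) ^ n" by (rule power_minus)
  ultimately show ?thesis
    using qq_diff by (cases "even n") (simp_all add: qint_def eigval_def power_int_minus mult.commute minus_divide_left)
qed

lemma qD_Suc: "qD (Suc k) l = qint qq (int l + int k) + (- 1) * qD k (l - 1)" if "l > 0"
proof -
  have "qD (Suc k) l = (\<Sum>i<Suc k. (- 1) ^ i * qint qq (int l + int k - 2 * int i))"
    by (simp add: qD_def)
  also have "\<dots> = qint qq (int l + int k) + (\<Sum>i<k. (- 1) ^ Suc i * qint qq (int l + int k - 2 * int (Suc i)))"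
    by (subst sum.lessThan_Suc_shift) simp
  also have "(\<Sum>i<k. (- 1) ^ Suc i * qint qq (int l + int k - 2 * int (Suc i))) = - qD k (l - 1)"
    using that unfolding qD_def sum_negf[symmetric]
    by (intro sum.cong) (auto simp: algebra_simps of_nat_diff)
  finally show ?thesis by simp
qed

text \<open>Since \<open>D(k+1,k+2) = [2k+2] - D(k,k+1)\<close> and
  \<open>[2][2k+2] = [2k+3] + [2k+1]\<close>, the alternating sum telescopes after multiplication by
  \<open>[2]\<close>.\<close>

lemma qint_2_qD: "qint qq 2 * qD k (Suc k) = qint qq (2 * int k + 1) - (- 1) ^ k * qint qq 1"
proof (induction k)
  case 0
  show ?case by (simp add: qD_def)
next
  case (Suc k)
  have "qint qq 2 * qD (Suc k) (Suc (Suc k)) = qint qq 2 * qint qq (2 * int k + 2) - qint qq 2 * qD k (Suc k)"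
    by (simp add: qD_Suc right_diff_distrib add_ac)
  then show ?case unfolding Suc.IH qint_2_mult by (simp add: add_ac)
qed

lemma qint_1: "qint qq 1 = 1"
  using qq_diff by (simp add: qint_def power_int_minus)

text \<open>As \<open>x = b - 1/[2]\<close>, this rewrites the factor
  \<open>x - (-1)^k D(k,k+1)\<close> of the recursion as \<open>b - eigval qq k\<close>.\<close>

lemma qD_eigval: "1 / qint qq 2 + (- 1) ^ k * qD k (Suc k) = eigval qq k"
proof -
  have "qint qq 2 * qD k (Suc k) = qint qq 2 * ((- 1) ^ k * eigval qq k) - (- 1) ^ k"
    using qint_2_qD[of k] qint_odd[of k] qint_2_neq_0 by (simp add: qint_1 field_simps)
  then have "qD k (Suc k) = (- 1) ^ k * eigval qq k - (- 1) ^ k / qint qq 2"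
    using qint_2_neq_0 by (simp add: field_simps)
  then show ?thesis by (simp add: right_diff_distrib flip: mult.assoc power_mult_distrib)
qed

lemma qint_qq2: "qint (qq^2) (int k) = ((qq^2) ^ k - inverse ((qq^2) ^ k)) / (qq^2 - inverse (qq^2))"
  by (simp add: qint_def power_int_minus)

section \<open>Representations of \<open>U\<^sup>\<iota>\<close>\<close>

lemma fgen_closed: "i \<in> {1..<m} \<Longrightarrow> fgen i \<in> carrier (free_alg m)"
  by (auto simp: free_alg_def fgen_def)

lemma fscal_closed: "fscal c \<in> carrier (free_alg m)"
  by (auto simp: free_alg_def fscal_def zero_free_word_def split: if_splits)

lemma free_alg_closed:
  assumes "a \<in> carrier (free_alg m)" "b \<in> carrier (free_alg m)"
  shows "a * b \<in> carrier (free_alg m)" "a + b \<in> carrier (free_alg m)"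
proof -
  interpret R: ring "free_alg m" by (rule ring_free_alg)
  show "a * b \<in> carrier (free_alg m)" "a + b \<in> carrier (free_alg m)"
    using R.m_closed[OF assms] R.a_closed[OF assms] by (simp_all add: free_alg_def)
qed

lemma so_rels_subset: "so_rels m \<subseteq> carrier (free_alg m)"
proof -
  have uminus: "- x \<in> carrier (free_alg m)" if "x \<in> carrier (free_alg m)" for x
    using that by (simp add: free_alg_def)
  have diff: "x - y \<in> carrier (free_alg m)"
    if "x \<in> carrier (free_alg m)" "y \<in> carrier (free_alg m)" for x y
    using free_alg_closed(2)[OF that(1) uminus[OF that(2)]] by simp
  show ?thesis
    by (auto simp: so_rels_def power2_eq_square intro!: fgen_closed fscal_closed free_alg_closed diff)
qed

lemma ideal_so_ideal: "ideal (so_ideal m) (free_alg m)"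
  unfolding so_ideal_def by (rule ring.genideal_ideal[OF ring_free_alg so_rels_subset])

lemma ring_Uso: "ring (Uso m)"
  unfolding Uso_def by (rule ideal.quotient_is_ring[OF ideal_so_ideal])

locale so_rep = vector_space scale for scale :: "Cq \<Rightarrow> 'v::ab_group_add \<Rightarrow> 'v" +
  fixes m :: nat and \<phi> :: "free_elem set \<Rightarrow> 'v \<Rightarrow> 'v"
  assumes rep: "so_representation m scale \<phi>"
begin

lemma hom: "\<phi> \<in> ring_hom (Uso m) (End_ring scale)"
  and \<phi>_Uscal: "\<phi> (Uscal m c) = scale c"
  using rep by (simp_all add: so_representation_def)

lemma \<phi>_mult: "a \<in> carrier (Uso m) \<Longrightarrow> b \<in> carrier (Uso m) \<Longrightarrow> \<phi> (a \<otimes>\<^bsub>Uso m\<^esub> b) v = \<phi> a (\<phi> b v)"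
  using ring_hom_mult[OF hom] by (simp add: End_ring_def)

lemma \<phi>_add: "a \<in> carrier (Uso m) \<Longrightarrow> b \<in> carrier (Uso m) \<Longrightarrow> \<phi> (a \<oplus>\<^bsub>Uso m\<^esub> b) v = \<phi> a v + \<phi> b v"
  using ring_hom_add[OF hom] by (simp add: End_ring_def)

lemma \<phi>_one: "\<phi> \<one>\<^bsub>Uso m\<^esub> v = v"
  using ring_hom_one[OF hom] by (simp add: End_ring_def)

lemma \<phi>_linear: "a \<in> carrier (Uso m) \<Longrightarrow> Vector_Spaces.linear scale scale (\<phi> a)"
  using ring_hom_closed[OF hom] by (simp add: End_ring_def)

text \<open>Additivity alone gives this, which avoids a proof that \<open>End_ring scale\<close> is
  a ring.\<close>

lemma \<phi>_zero: "\<phi> \<zero>\<^bsub>Uso m\<^esub> v = 0"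
proof -
  interpret U: ring "Uso m" by (rule ring_Uso)
  have "\<phi> \<zero>\<^bsub>Uso m\<^esub> v = \<phi> \<zero>\<^bsub>Uso m\<^esub> v + \<phi> \<zero>\<^bsub>Uso m\<^esub> v"
    using \<phi>_add[of "\<zero>\<^bsub>Uso m\<^esub>" "\<zero>\<^bsub>Uso m\<^esub>" v] by simp
  then show ?thesis by simp
qed

lemma \<phi>_minus:
  assumes "a \<in> carrier (Uso m)" "b \<in> carrier (Uso m)"
  shows "\<phi> (a \<ominus>\<^bsub>Uso m\<^esub> b) v = \<phi> a v - \<phi> b v"
proof -
  interpret U: ring "Uso m" by (rule ring_Uso)
  have "\<phi> ((a \<ominus>\<^bsub>Uso m\<^esub> b) \<oplus>\<^bsub>Uso m\<^esub> b) v = \<phi> (a \<ominus>\<^bsub>Uso m\<^esub> b) v + \<phi> b v"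
    using assms by (intro \<phi>_add) auto
  moreover have "(a \<ominus>\<^bsub>Uso m\<^esub> b) \<oplus>\<^bsub>Uso m\<^esub> b = a"
    using assms by (simp add: U.minus_eq U.a_assoc U.l_neg)
  ultimately show ?thesis by (simp add: eq_diff_eq)
qed

text \<open>The pullback of \<open>\<phi>\<close> to the free algebra, where the defining relations
  can be evaluated term by term.\<close>

definition lift :: "free_elem \<Rightarrow> 'v \<Rightarrow> 'v" where
  "lift a = \<phi> (so_ideal m +>\<^bsub>free_alg m\<^esub> a)"

lemma coset_closed: "a \<in> carrier (free_alg m) \<Longrightarrow> so_ideal m +>\<^bsub>free_alg m\<^esub> a \<in> carrier (Uso m)"
  using ring_hom_closed[OF ideal.rcos_ring_hom[OF ideal_so_ideal]] by (simp add: Uso_def)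

lemmas Ugen_closed = coset_closed[OF fgen_closed, folded Ugen_def]
lemmas Uscal_closed = coset_closed[OF fscal_closed, folded Uscal_def]

lemma lift_mult: "a \<in> carrier (free_alg m) \<Longrightarrow> b \<in> carrier (free_alg m) \<Longrightarrow> lift (a * b) v = lift a (lift b v)"
  using ring_hom_mult[OF ideal.rcos_ring_hom[OF ideal_so_ideal], of a m b]
    \<phi>_mult[OF coset_closed coset_closed, of a b v]
  by (simp add: lift_def Uso_def free_alg_def)

lemma lift_add: "a \<in> carrier (free_alg m) \<Longrightarrow> b \<in> carrier (free_alg m) \<Longrightarrow> lift (a + b) v = lift a v + lift b v"
  using ring_hom_add[OF ideal.rcos_ring_hom[OF ideal_so_ideal], of a m b]
    \<phi>_add[OF coset_closed coset_closed, of a b v]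
  by (simp add: lift_def Uso_def free_alg_def)

end


section \<open>Generators and divided powers as operators\<close>

context so_rep
begin

abbreviation op :: "nat \<Rightarrow> 'v \<Rightarrow> 'v" where "op i \<equiv> \<phi> (Ugen m i)"

lemma lift_fgen: "lift (fgen i) = op i"
  by (simp add: lift_def Ugen_def)

lemma lift_fscal: "lift (fscal c) = scale c"
  using \<phi>_Uscal by (simp add: lift_def Uscal_def)

lemma lift_rel:
  assumes "a - b \<in> so_rels m" "b \<in> carrier (free_alg m)"
  shows "lift a v = lift b v"
proof -
  interpret I: ideal "so_ideal m" "free_alg m" by (rule ideal_so_ideal)
  have mem: "a - b \<in> so_ideal m"
    using assms(1) ring.genideal_self[OF ring_free_alg so_rels_subset] by (auto simp: so_ideal_def)
  have "so_ideal m +>\<^bsub>free_alg m\<^esub> (a - b) = so_ideal m"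
    using mem by (rule I.a_rcos_const)
  then have "lift (a - b) v = 0"
    using \<phi>_zero by (simp add: lift_def Uso_def FactRing_def)
  moreover have "lift ((a - b) + b) v = lift (a - b) v + lift b v"
    using I.a_Hcarr[OF mem] assms(2) by (rule lift_add)
  ultimately show ?thesis by simp
qed

lemma op_far:
  assumes "i \<in> {1..<m}" "j \<in> {1..<m}" "\<bar>int i - int j\<bar> > 1"
  shows "op i (op j v) = op j (op i v)"
proof -
  have "lift (fgen i * fgen j) v = lift (fgen j * fgen i) v"
    using assms by (intro lift_rel free_alg_closed fgen_closed) (auto simp: so_rels_def)
  then show ?thesis using assms by (simp add: lift_mult fgen_closed lift_fgen)
qed

lemma op_adjacent:
  assumes "i \<in> {1..<m}" "j \<in> {1..<m}" "\<bar>int i - int j\<bar> = 1"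
  shows "op i (op i (op j v)) + op j (op i (op i v)) =
    scale (- (qq^2 + inverse (qq^2))) (op i (op j (op i v))) + op j v"
proof -
  have "qint (qq^2) 2 = qq^2 + inverse (qq^2)"
  proof -
    have "(qq^2)^2 - inverse ((qq^2)^2) = (qq^2 + inverse (qq^2)) * (qq^2 - inverse (qq^2))"
      by (simp add: algebra_simps power2_eq_square qq_neq_0)
    then show ?thesis using qint_qq2[of 2] q2_diff[OF qq] by simp
  qed
  moreover have "lift (fgen i ^ 2 * fgen j + fgen j * fgen i ^ 2) v =
      lift (fscal (- qint (qq ^ 2) 2) * fgen i * fgen j * fgen i + fgen j) v"
    using assms by (intro lift_rel free_alg_closed fgen_closed fscal_closed) (auto simp: so_rels_def)
  ultimately show ?thesis using assms
    by (simp add: power2_eq_square lift_add lift_mult free_alg_closed fgen_closed fscal_closed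
        lift_fgen lift_fscal mult.assoc)
qed

lemma idivpow_closed:
  assumes i: "i \<in> {1..<m}"
  shows "idivpow m i k \<in> carrier (Uso m)"
proof -
  interpret U: ring "Uso m" by (rule ring_Uso)
  show ?thesis
    by (induction k rule: induct_nat_012) (simp_all add: Ux_def Ugen_closed[OF i] Uscal_closed)
qed

text \<open>By \<open>qD_eigval\<close> the two nontrivial clauses of \<open>idivpow\<close> become
  one recursion; for \<open>k = 0\<close> it uses \<open>D(0,1) = 0\<close> and
  \<open>[1] = 1\<close>.\<close>

lemma idivpow_Suc:
  assumes i: "i \<in> {1..<m}"
  shows "\<phi> (idivpow m i (Suc k)) v =
    scale ((- 1) ^ k / qint (qq^2) (int (Suc k))) (\<phi> (idivpow m i k) (op i v - scale (eigval qq k) v))"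
proof -
  interpret U: ring "Uso m" by (rule ring_Uso)
  interpret X: Vector_Spaces.linear scale scale "\<phi> (idivpow m i k)"
    by (rule \<phi>_linear[OF idivpow_closed[OF i]])
  note closed = Ugen_closed[OF i] Uscal_closed idivpow_closed[OF i]
  have Ux: "\<phi> (Ux m i) v = op i v - scale (1 / qint qq 2) v" and Ux_closed: "Ux m i \<in> carrier (Uso m)" for v
    by (simp_all add: Ux_def closed \<phi>_minus \<phi>_Uscal)
  show ?thesis
  proof (cases k)
    case 0
    then show ?thesis
      using Ux qD_eigval[of 0] qint_qq2[of 1] q2_diff[OF qq] by (simp add: qD_def \<phi>_one)
  next
    case (Suc k')
    have "\<phi> (idivpow m i (Suc k)) v = scale ((- 1) ^ k / qint (qq^2) (int (Suc k)))
        (\<phi> (idivpow m i k) (op i v - scale (1 / qint qq 2) v)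
          - scale ((- 1) ^ k * qD k (Suc k)) (\<phi> (idivpow m i k) v))"
      unfolding Suc idivpow.simps(3) by (simp add: \<phi>_mult \<phi>_minus \<phi>_Uscal closed Ux Ux_closed del: idivpow.simps)
    also have "\<phi> (idivpow m i k) (op i v - scale (1 / qint qq 2) v)
          - scale ((- 1) ^ k * qD k (Suc k)) (\<phi> (idivpow m i k) v) =
        \<phi> (idivpow m i k) (op i v - scale (eigval qq k) v)"
      unfolding qD_eigval[of k, symmetric] X.diff X.scale scale_left_distrib X.add by simp
    finally show ?thesis .
  qed
qed

lemma idivpow_eigenvector:
  assumes i: "i \<in> {1..<m}" and v: "op i v = scale (eigval qq n) v"
  shows "scale (inverse qq ^ k) (\<phi> (idivpow m i k) v) = scale (vterm (inverse (- (qq^2))) n k) v"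
proof (induction k)
  case 0
  then show ?case by (simp add: \<phi>_one)
next
  case (Suc k)
  interpret X: Vector_Spaces.linear scale scale "\<phi> (idivpow m i k)"
    by (rule \<phi>_linear[OF idivpow_closed[OF i]])
  define c where "c = (- 1) ^ k / qint (qq^2) (int (Suc k)) * (eigval qq n - eigval qq k)"
  have "\<phi> (idivpow m i (Suc k)) v = scale c (\<phi> (idivpow m i k) v)"
    unfolding idivpow_Suc[OF i] v scale_left_diff_distrib[symmetric] X.scale by (simp add: c_def)
  then have "scale (inverse qq ^ Suc k) (\<phi> (idivpow m i (Suc k)) v) =
      scale (inverse qq * c) (scale (inverse qq ^ k) (\<phi> (idivpow m i k) v))"
    by (simp add: mult_ac)
  also have "inverse qq * c = inverse qq * ((- 1) ^ k * ((qq^2 - inverse (qq^2)) /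
      ((qq^2) ^ Suc k - inverse ((qq^2) ^ Suc k)))) * (eigval qq n - eigval qq k)"
    unfolding c_def qint_qq2 by simp
  finally show ?case
    unfolding Suc.IH vterm_step[OF qq] Let_def by (simp only: vterm_Suc scale_scale)
qed

end

section \<open>The operators \<open>\<beta>\<^sub>i\<close> on a nonclassical representation\<close>

locale nonclassical = so_rep +
  assumes eigenvectors_span: "i \<in> {1..<m} \<Longrightarrow> span {v. \<exists>n. op i v = scale (eigval qq n) v} = UNIV"
begin

text \<open>On the \<open>n\<close>-th eigenspace the factor \<open>b - eigval qq n\<close> enters
  every divided power of index above \<open>n\<close>. Linear combinations take the maximum of the
  bounds.\<close>

lemma idivpow_eventually_0:
  assumes i: "i \<in> {1..<m}"
  shows "\<exists>N. \<forall>k\<ge>N. \<phi> (idivpow m i k) v = 0"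
proof -
  interpret X: Vector_Spaces.linear scale scale "\<phi> (idivpow m i k)" for k
    by (rule \<phi>_linear[OF idivpow_closed[OF i]])
  have "v \<in> span {v. \<exists>n. op i v = scale (eigval qq n) v}" using eigenvectors_span[OF i] by simp
  then show ?thesis
  proof (induction rule: span_induct_alt)
    case base
    show ?case by (simp add: X.zero)
  next
    case (step c x y)
    then obtain n N where n: "op i x = scale (eigval qq n) x" and N: "\<And>k. k \<ge> N \<Longrightarrow> \<phi> (idivpow m i k) y = 0"
      by blast
    have "\<phi> (idivpow m i k) x = 0" if "k > n" for k
      using idivpow_eigenvector[OF i n, of k] vterm_eq_0[OF inverse_mqq2(1) that] qq_neq_0 by simp
    then have "\<phi> (idivpow m i k) (scale c x + y) = 0" if "k \<ge> max (Suc n) N" for k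
      using N that by (simp add: X.add X.scale)
    then show ?case by blast
  qed
qed

lemma idivpow_finite_support:
  assumes "i \<in> {1..<m}"
  shows "finite {k. \<phi> (idivpow m i k) v \<noteq> 0}"
proof -
  obtain N where "\<forall>k\<ge>N. \<phi> (idivpow m i k) v = 0"
    using idivpow_eventually_0[OF assms] by blast
  then have "{k. \<phi> (idivpow m i k) v \<noteq> 0} \<subseteq> {..<N}" using not_le by blast
  then show ?thesis by (rule finite_subset) simp
qed

text \<open>Any bound past the support will do, so sums for several vectors can share one
  range.\<close>

lemma braid_op_eq_sum:
  assumes "\<And>k. k > N \<Longrightarrow> \<phi> (idivpow m i k) v = 0"
  shows "braid_op m scale \<phi> i v = (\<Sum>k\<le>N. scale (inverse qq ^ k) (\<phi> (idivpow m i k) v))"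
proof -
  have "k \<le> N" if "\<phi> (idivpow m i k) v \<noteq> 0" for k
    using assms that by (meson not_le)
  then show ?thesis
    unfolding braid_op_def by (intro Sum_any.expand_superset) auto
qed

lemma linear_braid_op:
  assumes i: "i \<in> {1..<m}"
  shows "Vector_Spaces.linear scale scale (braid_op m scale \<phi> i)"
proof -
  interpret X: Vector_Spaces.linear scale scale "\<phi> (idivpow m i k)" for k
    by (rule \<phi>_linear[OF idivpow_closed[OF i]])
  have "braid_op m scale \<phi> i (x + y) = braid_op m scale \<phi> i x + braid_op m scale \<phi> i y" for x y
  proof -
    obtain M N where "\<forall>k\<ge>M. \<phi> (idivpow m i k) x = 0" "\<forall>k\<ge>N. \<phi> (idivpow m i k) y = 0"
      using idivpow_eventually_0[OF i] by meson
    then show ?thesis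
      by (subst (1 2 3) braid_op_eq_sum[where N = "max M N"])
        (auto simp: X.add scale_right_distrib sum.distrib)
  qed
  moreover have "braid_op m scale \<phi> i (scale c x) = scale c (braid_op m scale \<phi> i x)" for c x
  proof -
    obtain N where "\<forall>k\<ge>N. \<phi> (idivpow m i k) x = 0"
      using idivpow_eventually_0[OF i] by meson
    then show ?thesis
      by (subst (1 2) braid_op_eq_sum[where N = N]) (auto simp: X.scale scale_sum_right mult.commute)
  qed
  ultimately show ?thesis by (simp add: Vector_Spaces.linear_iff vector_space_axioms)
qed

lemma spectral_braid_op:
  assumes i: "i \<in> {1..<m}"
  shows "spectral_op (eigval qq) (\<lambda>n. \<Prod>j\<le>n. inverse (- (qq^2)) ^ j) (op i) (braid_op m scale \<phi> i)"
  unfolding spectral_op_def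
proof (intro conjI allI impI)
  show "Vector_Spaces.linear scale scale (op i)" by (rule \<phi>_linear[OF Ugen_closed[OF i]])
  show "Vector_Spaces.linear scale scale (braid_op m scale \<phi> i)" by (rule linear_braid_op[OF i])
  show "span {v. \<exists>n. op i v = scale (eigval qq n) v} = UNIV" by (rule eigenvectors_span[OF i])
  fix n v assume v: "op i v = scale (eigval qq n) v"
  note ev = idivpow_eigenvector[OF i v]
  have "\<phi> (idivpow m i k) v = 0" if "k > n" for k
    using ev[of k] vterm_eq_0[OF inverse_mqq2(1) that] qq_neq_0 by simp
  then have "braid_op m scale \<phi> i v = (\<Sum>k\<le>n. scale (vterm (inverse (- (qq^2))) n k) v)"
    by (subst braid_op_eq_sum[where N = n]) (simp_all only: ev)
  then show "braid_op m scale \<phi> i v = scale (\<Prod>j\<le>n. inverse (- (qq^2)) ^ j) v"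
    by (simp only: sum_vterm[OF inverse_mqq2 order.refl] flip: scale_sum_left)
qed

lemma surj_braid_op:
  assumes i: "i \<in> {1..<m}"
  shows "surj (braid_op m scale \<phi> i)"
  by (rule spectral_op_surj[OF spectral_braid_op[OF i]]) (simp add: qq_neq_0)

lemma braid_op_far:
  assumes "i \<in> {1..<m}" "j \<in> {1..<m}" "\<bar>int i - int j\<bar> > 1"
  shows "braid_op m scale \<phi> i (braid_op m scale \<phi> j v) = braid_op m scale \<phi> j (braid_op m scale \<phi> i v)"
  using assms by (intro spectral_op_commute[OF spectral_braid_op spectral_braid_op] op_far)

lemma braid_op_braid:
  assumes "i \<in> {1..<m}" "j \<in> {1..<m}" "\<bar>int i - int j\<bar> = 1"
  shows "braid_op m scale \<phi> i (braid_op m scale \<phi> j (braid_op m scale \<phi> i v)) =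
    braid_op m scale \<phi> j (braid_op m scale \<phi> i (braid_op m scale \<phi> j v))"
  using assms
  by (intro spectral_op_braid[OF qq spectral_braid_op spectral_braid_op] op_adjacent) auto

end

text \<open>Members of a diagonalizing basis are nonzero, so their scalars are eigenvalues and
  therefore admissible.\<close>

lemma nonclassical_repD:
  assumes "vector_space scale" and nc: "nonclassical_rep m scale \<phi>"
  shows "nonclassical scale m \<phi>"
proof -
  interpret vector_space scale by fact
  interpret so_rep scale m \<phi>
    using nc by unfold_locales (simp add: nonclassical_rep_def)
  show ?thesis
  proof unfold_locales
    fix i assume i: "i \<in> {1..<m}"
    have "diagonalizable scale (op i)" using nc i unfolding nonclassical_rep_def by blast
    then obtain B where B: "independent B" "span B = UNIV" "\<And>v. v \<in> B \<Longrightarrow> \<exists>c. op i v = scale c v"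
      unfolding diagonalizable_def by blast
    have "B \<subseteq> {v. \<exists>n. op i v = scale (eigval qq n) v}"
    proof clarify
      fix v assume "v \<in> B"
      then obtain c where c: "op i v = scale c v" using B(3) by blast
      have "v \<noteq> 0" using \<open>v \<in> B\<close> B(1) dependent_zero by blast
      with c have "c \<in> eigenvalues scale (op i)" by (auto simp: eigenvalues_def)
      then obtain n where "c = (- 1) ^ n * (qint qq (2 * int n + 1) / qint qq 2)"
        using nc i unfolding nonclassical_rep_def by fastforce
      then have "c = eigval qq n" unfolding qint_odd by (simp flip: mult.assoc power_mult_distrib)
      with c show "\<exists>n. op i v = scale (eigval qq n) v" by blast
    qed
    then show "span {v. \<exists>n. op i v = scale (eigval qq n) v} = UNIV"
      using B(2) span_mono by blast
  qed
qed

section \<open>Actions of the braid group\<close>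

text \<open>The rightmost letter acts first. \<open>inv_into UNIV (T i)\<close> is a two-sided
  inverse only for bijective \<open>T i\<close>.\<close>

fun braid_act :: "(nat \<Rightarrow> 'v \<Rightarrow> 'v) \<Rightarrow> braid_word \<Rightarrow> 'v \<Rightarrow> 'v" where
  "braid_act T [] = id"
| "braid_act T ((i, e) # w) = (if e then T i else inv_into UNIV (T i)) \<circ> braid_act T w"

lemma braid_act_append: "braid_act T (u @ v) = braid_act T u \<circ> braid_act T v"
  by (induction T u rule: braid_act.induct) (auto simp: fun_eq_iff)

lemma bij_braid_act:
  assumes "\<And>i. i \<in> {1..<m} \<Longrightarrow> bij (T i)" "u \<in> braid_words m"
  shows "bij (braid_act T u)"
  using assms(2)
  by (induction u) (auto simp: braid_words_def intro!: bij_comp bij_imp_bij_inv assms(1))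

lemma BijGroup_UNIV:
  assumes "f \<in> carrier (BijGroup UNIV)" "g \<in> carrier (BijGroup UNIV)"
  shows "f \<otimes>\<^bsub>BijGroup UNIV\<^esub> g = f \<circ> g"
  using assms by (auto simp: BijGroup_def compose_def)

lemma braid_class_closed: "u \<in> braid_words m \<Longrightarrow> braid_class m u \<in> carrier (braid_group m)"
  by (simp add: braid_group_def)

text \<open>Every class is a product of letters, and the cancellation relation forces an inverse
  letter to act by the inverse function.\<close>

lemma braid_action_unique:
  fixes T :: "nat \<Rightarrow> 'v \<Rightarrow> 'v"
  assumes act: "group_action (braid_group m) UNIV \<rho>"
    and gen: "\<And>i. i \<in> {1..<m} \<Longrightarrow> \<rho> (braid_gen m i) = T i"
    and u: "u \<in> braid_words m"
  shows "\<rho> (braid_class m u) = braid_act T u"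
proof -
  interpret group_action "braid_group m" UNIV \<rho> by fact
  interpret group_hom "braid_group m" "BijGroup UNIV" \<rho> by (rule group_hom)
  have mult: "\<rho> (braid_class m (u @ v)) = \<rho> (braid_class m u) \<circ> \<rho> (braid_class m v)"
    if "u \<in> braid_words m" "v \<in> braid_words m" for u v
    using that by (simp add: BijGroup_UNIV braid_class_closed flip: braid_class_mult)
  have nil: "\<rho> (braid_class m []) = id"
    using id_eq_one by (simp add: braid_group_def restrict_def id_def)
  have letter: "\<rho> (braid_class m [(i, e)]) = (if e then T i else inv_into UNIV (T i))" if i: "i \<in> {1..<m}" for i e
  proof (cases e)
    case True
    then show ?thesis using gen[OF i] by (simp add: braid_gen_def)
  next
    case False
    have w: "[(i, e)] \<in> braid_words m" for e using i by (simp add: braid_words_def)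
    have comp: "\<rho> (braid_class m [(i, e)]) \<circ> \<rho> (braid_class m [(i, \<not> e)]) = id" for e
      using mult[OF w w, of e "\<not> e"] braid_class_eqI[OF braid_eq.cancel[OF i, of e]] nil by simp
    have "inv_into UNIV (\<rho> (braid_class m [(i, True)])) = \<rho> (braid_class m [(i, False)])"
      using comp[of True] comp[of False] by (intro inv_unique_comp) simp_all
    then show ?thesis using False gen[OF i] by (simp add: braid_gen_def)
  qed
  show ?thesis using u
  proof (induction u)
    case (Cons a w)
    obtain i e where a: "a = (i, e)" by (cases a)
    have "[(i, e)] \<in> braid_words m" "w \<in> braid_words m" "i \<in> {1..<m}"
      using Cons.prems by (auto simp: braid_words_def a)
    then show ?case using mult[of "[(i, e)]" w] letter[of i e] Cons.IH by (simp add: a)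
  qed (simp add: nil)
qed

lemma braid_action_exists:
  fixes T :: "nat \<Rightarrow> 'v \<Rightarrow> 'v"
  assumes bij: "\<And>i. i \<in> {1..<m} \<Longrightarrow> bij (T i)"
    and comm: "\<And>i j v. i \<in> {1..<m} \<Longrightarrow> j \<in> {1..<m} \<Longrightarrow> \<bar>int i - int j\<bar> > 1 \<Longrightarrow> T i (T j v) = T j (T i v)"
    and braid_rel: "\<And>i j v. i \<in> {1..<m} \<Longrightarrow> j \<in> {1..<m} \<Longrightarrow> \<bar>int i - int j\<bar> = 1 \<Longrightarrow>
      T i (T j (T i v)) = T j (T i (T j v))"
  obtains \<rho> where "\<rho> \<in> extensional (carrier (braid_group m))"
    "group_action (braid_group m) UNIV \<rho>"
    "\<And>u. u \<in> braid_words m \<Longrightarrow> \<rho> (braid_class m u) = braid_act T u"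
proof -
  have resp: "braid_act T u = braid_act T v" if "braid_eq m u v" for u v
    using that
  proof induction
    case (app u u' v v')
    then show ?case by (simp add: braid_act_append)
  next
    case (cancel i e)
    then show ?case
      using bij[of i] by (auto simp: fun_eq_iff bij_is_inj bij_is_surj surj_f_inv_f)
  next
    case (far i j)
    then show ?case using comm[OF far.hyps] by (simp add: fun_eq_iff)
  next
    case (braid i j)
    then show ?case using braid_rel[OF braid.hyps] by (simp add: fun_eq_iff)
  qed simp_all
  \<comment> \<open>By \<open>resp\<close> the chosen representative does not matter; the restricted
    abstraction makes \<open>\<rho>\<close> extensional.\<close>
  define \<rho> where "\<rho> = (\<lambda>g\<in>carrier (braid_group m).
    braid_act T (SOME u. u \<in> braid_words m \<and> g = braid_class m u))"
  have \<rho>: "\<rho> (braid_class m u) = braid_act T u" if u: "u \<in> braid_words m" for u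
  proof -
    define w where "w = (SOME w. w \<in> braid_words m \<and> braid_class m u = braid_class m w)"
    have w: "w \<in> braid_words m \<and> braid_class m u = braid_class m w"
      unfolding w_def by (rule someI[of _ u]) (use u in simp)
    then have "w \<in> braid_class m u" by (simp add: braid_class_def braid_eq.refl)
    then have "braid_act T u = braid_act T w" by (auto simp: braid_class_def resp)
    then show ?thesis using u by (simp add: \<rho>_def braid_class_closed w_def)
  qed
  have carr: "carrier (braid_group m) = braid_class m ` braid_words m" by (simp add: braid_group_def)
  have "\<rho> \<in> hom (braid_group m) (BijGroup UNIV)"
  proof (rule homI)
    have closed: "braid_act T u \<in> carrier (BijGroup UNIV)" if "u \<in> braid_words m" for u
      using bij_braid_act[OF bij that] by (simp add: BijGroup_def Bij_def)
    fix g assume "g \<in> carrier (braid_group m)"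
    then obtain u where u: "g = braid_class m u" "u \<in> braid_words m" by (auto simp: carr)
    then show "\<rho> g \<in> carrier (BijGroup UNIV)" using closed by (simp add: \<rho>)
    fix h assume "h \<in> carrier (braid_group m)"
    then obtain v where v: "h = braid_class m v" "v \<in> braid_words m" by (auto simp: carr)
    have "u @ v \<in> braid_words m" using u v by (auto simp: braid_words_def)
    then show "\<rho> (g \<otimes>\<^bsub>braid_group m\<^esub> h) = \<rho> g \<otimes>\<^bsub>BijGroup UNIV\<^esub> \<rho> h"
      using u v closed by (simp add: braid_class_mult \<rho> BijGroup_UNIV braid_act_append)
  qed
  then have "group_action (braid_group m) UNIV \<rho>"
    unfolding group_action_def group_hom_def group_hom_axioms_def
    by (simp add: group_braid_group group_BijGroup)
  moreover have "\<rho> \<in> extensional (carrier (braid_group m))" by (simp add: \<rho>_def)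
  ultimately show ?thesis using that \<rho> by blast
qed

lemma linear_braid_act:
  assumes "vector_space scale"
    and lin: "\<And>i. i \<in> {1..<m} \<Longrightarrow> Vector_Spaces.linear scale scale (T i)"
    and bij: "\<And>i. i \<in> {1..<m} \<Longrightarrow> bij (T i)" and u: "u \<in> braid_words m"
  shows "Vector_Spaces.linear scale scale (braid_act T u)"
proof -
  interpret vector_space scale by fact
  have inv: "Vector_Spaces.linear scale scale (inv_into UNIV (T i))" if i: "i \<in> {1..<m}" for i
  proof -
    interpret T: Vector_Spaces.linear scale scale "T i" by (rule lin[OF i])
    have TI: "T i (inv_into UNIV (T i) x) = x" for x using bij[OF i] by (simp add: bij_is_surj surj_f_inv_f)
    have invI: "inv_into UNIV (T i) y = x" if "T i x = y" for x y using bij[OF i] that by (auto simp: bij_is_inj)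
    show ?thesis
      by (auto simp: Vector_Spaces.linear_iff vector_space_axioms T.add T.scale TI intro!: invI)
  qed
  show ?thesis using u
    by (induction u) (use lin inv in \<open>auto simp: braid_words_def Vector_Spaces.linear_iff vector_space_axioms\<close>)
qed

text \<open>Finite support ensures that \<open>Sum_any\<close> is a genuine sum and not its default
  \<open>0\<close>. Extensionality pins \<open>\<rho>\<close> down outside the carrier, so that
  uniqueness concerns the action itself.\<close>

theorem theorem1p14:
  fixes m :: nat
    and scale :: "Cq \<Rightarrow> 'v::ab_group_add \<Rightarrow> 'v"
    and Basis :: "'v set"
    and \<phi> :: "free_elem set \<Rightarrow> 'v \<Rightarrow> 'v"
  assumes "finite_dimensional_vector_space scale Basis"
    and "nonclassical_rep m scale \<phi>"
  shows "(\<forall>i\<in>{1..<m}. \<forall>v. finite {k. \<phi> (idivpow m i k) v \<noteq> 0}) \<and>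
    (\<exists>!\<rho>. \<rho> \<in> extensional (carrier (braid_group m)) \<and>
       group_action (braid_group m) (UNIV :: 'v set) \<rho> \<and>
       (\<forall>g \<in> carrier (braid_group m). Vector_Spaces.linear scale scale (\<rho> g)) \<and>
       (\<forall>i\<in>{1..<m}. \<rho> (braid_gen m i) = braid_op m scale \<phi> i))"
proof -
  interpret finite_dimensional_vector_space scale Basis by fact
  interpret nonclassical scale m \<phi>
    using vector_space_axioms assms(2) by (rule nonclassical_repD)
  let ?T = "braid_op m scale \<phi>"
  \<comment> \<open>Finite dimension enters here: a surjective endomorphism is injective.\<close>
  have bij: "bij (?T i)" if "i \<in> {1..<m}" for i
    using surj_braid_op[OF that] linear_surj_imp_inj[OF linear_braid_op[OF that]]
    by (simp add: bij_def)
  have carr: "carrier (braid_group m) = braid_class m ` braid_words m" by (simp add: braid_group_def)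
  obtain \<rho> where \<rho>: "\<rho> \<in> extensional (carrier (braid_group m))" "group_action (braid_group m) UNIV \<rho>"
    "\<And>u. u \<in> braid_words m \<Longrightarrow> \<rho> (braid_class m u) = braid_act ?T u"
    using braid_action_exists[of m ?T, OF bij braid_op_far braid_op_braid] by blast
  have lin: "\<forall>g \<in> carrier (braid_group m). Vector_Spaces.linear scale scale (\<rho> g)"
    using linear_braid_act[OF vector_space_axioms linear_braid_op bij] by (auto simp: carr \<rho>(3))
  have gen: "\<rho> (braid_gen m i) = ?T i" if "i \<in> {1..<m}" for i
    using that by (simp add: braid_gen_def \<rho>(3) braid_words_def)
  have unique: "\<rho>' = \<rho>" if "\<rho>' \<in> extensional (carrier (braid_group m))"
    "group_action (braid_group m) UNIV \<rho>'" "\<forall>i\<in>{1..<m}. \<rho>' (braid_gen m i) = ?T i" for \<rho>'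
  proof (rule extensionalityI[OF that(1) \<rho>(1)])
    fix g assume "g \<in> carrier (braid_group m)"
    then obtain u where u: "g = braid_class m u" "u \<in> braid_words m" by (auto simp: carr)
    have "\<rho>' (braid_class m u) = braid_act ?T u"
      using that(3) by (intro braid_action_unique[OF that(2) _ u(2)]) blast
    then show "\<rho>' g = \<rho> g" using u \<rho>(3) by simp
  qed
  show ?thesis
  proof (intro conjI ballI allI ex1I[of _ \<rho>])
    fix i v assume "i \<in> {1..<m}"
    then show "finite {k. \<phi> (idivpow m i k) v \<noteq> 0}" by (rule idivpow_finite_support)
  qed (use \<rho>(1,2) lin gen unique in \<open>assumption | blast\<close>)+
qed

end
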